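(* For any $p\in(0,1)$, the Bloch constant $B(p)$ and the Landau constant $L(p)$ for the class $\mathcal{A}_1(p)$ are infinite, i.e. $B(p)=L(p)=\infty$.
   Context: Let $\mathbb{D}=\{z\in\mathbb{C}:|z|<1\}$. For $p\in(0,1)$, $\mathcal{A}_1(p)$ is the class of all meromorphic functions $f$ in $\mathbb{D}$ having a simple pole at $p$, analytic in $\mathbb{D}\setminus\{p\}$, and normalized by $f'(0)=1$. For $f\in\mathcal{A}_1(p)$, $L_f(p)$ is the radius of the largest disk contained in $f(\mathbb{D})$, i.e. the supremum in $[0,\infty]$ of the radii of open Euclidean disks in $\mathbb{C}$ contained in $f(\mathbb{D})$. $B_f(p)$ is the radius of the largest schlicht disk contained in $f(\mathbb{D})$, i.e. the supremum in $[0,\infty]$ of the radii of schlicht disks, where a schlicht disk is an open Euclidean disk $\Delta\subset\mathbb{C}$ for which there is a subdomain $U\subset\mathbb{D}$ such that $f$ is univalent on $U$ and $f(U)=\Delta$. The Landau and Bloch constants of the class are $L(p)=\inf\{L_f(p):f\in\mathcal{A}_1(p)\}$ and $B(p)=\inf\{B_f(p):f\in\mathcal{A}_1(p)\}$. *)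

theory Defs
  imports "HOL-Complex_Analysis.Complex_Analysis"
begin

abbreviation unit_disk :: "complex set" (\<open>\<bbbD>\<close>) where
  "\<bbbD> \<equiv> ball 0 1"

text \<open>The value of \<open>f\<close> at the pole \<open>p\<close> is meant to be the point at infinity. The number that
  the total function \<open>f\<close> takes there is arbitrary, and \<open>p\<close> is therefore removed from the
  domain wherever finite values of \<open>f\<close> are considered.\<close>

definition class_A1 :: "real \<Rightarrow> (complex \<Rightarrow> complex) set" where
  "class_A1 p = {f. f meromorphic_on \<bbbD> \<and> f analytic_on (\<bbbD> - {of_real p}) \<and>
     is_pole f (of_real p) \<and> zorder f (of_real p) = -1 \<and> deriv f 0 = 1}"

definition finite_image :: "real \<Rightarrow> (complex \<Rightarrow> complex) \<Rightarrow> complex set" where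
  "finite_image p f = f ` (\<bbbD> - {of_real p})"

text \<open>A subdomain on which \<open>f\<close> has finite values cannot contain the pole. Nonemptiness of \<open>U\<close>
  follows from \<open>r > 0\<close>.\<close>

definition schlicht_disk :: "real \<Rightarrow> (complex \<Rightarrow> complex) \<Rightarrow> complex \<Rightarrow> real \<Rightarrow> bool" where
  "schlicht_disk p f c r \<longleftrightarrow> r > 0 \<and>
     (\<exists>U. open U \<and> connected U \<and> U \<subseteq> \<bbbD> - {of_real p} \<and> inj_on f U \<and> f ` U = ball c r)"

text \<open>Suprema and infima are taken in \<^typ>\<open>ennreal\<close>, that is, in \<open>[0, \<infinity>]\<close>.\<close>

definition landau_radius :: "real \<Rightarrow> (complex \<Rightarrow> complex) \<Rightarrow> ennreal" where
  "landau_radius p f = Sup {ennreal r | r c. r > 0 \<and> ball c r \<subseteq> finite_image p f}"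

definition bloch_radius :: "real \<Rightarrow> (complex \<Rightarrow> complex) \<Rightarrow> ennreal" where
  "bloch_radius p f = Sup {ennreal r | r c. schlicht_disk p f c r}"

definition landau_const :: "real \<Rightarrow> ennreal" where
  "landau_const p = (INF f\<in>class_A1 p. landau_radius p f)"

definition bloch_const :: "real \<Rightarrow> ennreal" where
  "bloch_const p = (INF f\<in>class_A1 p. bloch_radius p f)"

end

theory Submission
  imports Defs
begin

text \<open>Both radii are infinite for each individual function of the class. A simple pole makes
  \<open>1/f\<close> univalent near \<open>p\<close>, with value \<open>0\<close> at \<open>p\<close>, so a small disk around \<open>p\<close> is mapped by
  \<open>f\<close> univalently onto a set that contains a punctured neighbourhood of infinity. Such a
  neighbourhood contains disks of every radius, and each of them is schlicht
  (\<open>simple_pole_univalent_onto_disk\<close>). The Landau radius dominates the Bloch radius, so it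
  is infinite as well.\<close>

text \<open>The function \<open>g\<close> is \<open>1/f\<close>, extended to the pole: writing
  \<open>f w = h w / (w - z)\<close> with \<open>h z \<noteq> 0\<close>, the quotient \<open>(w - z) / h w\<close> has the nonzero
  derivative \<open>1 / h z\<close> at \<open>z\<close>, which gives local injectivity.\<close>

lemma simple_pole_reciprocal_locally_injective:
  assumes "f holomorphic_on S - {z}" "open S" "z \<in> S" "is_pole f z" "zorder f z = -1"
  obtains g e where "e > 0" "ball z e \<subseteq> S" "g holomorphic_on ball z e" "inj_on g (ball z e)"
    "g z = 0" "\<forall>w\<in>ball z e - {z}. f w = inverse (g w)"
proof -
  have hz: "zor_poly f z z \<noteq> 0"
    using zorder_exist_pole[OF assms(1-4)] by simp
  obtain r where r: "r > 0" "cball z r \<subseteq> S" "zor_poly f z holomorphic_on cball z r"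
    and on_punctured: "\<forall>w\<in>cball z r - {z}. f w = zor_poly f z w / (w - z) ^ nat (- zorder f z)
      \<and> zor_poly f z w \<noteq> 0"
    using zorder_exist_pole[OF assms(1-4)] by blast
  have f_eq: "f w = zor_poly f z w / (w - z)" if "w \<in> cball z r - {z}" for w
    using on_punctured that assms(5) by simp
  have nz: "zor_poly f z w \<noteq> 0" if "w \<in> cball z r" for w
    using on_punctured hz that by (cases "w = z") simp_all
  define h where "h = zor_poly f z"
  define g where "g = (\<lambda>w. (w - z) / h w)"
  have h_hol: "h holomorphic_on ball z r"
    using r(3) ball_subset_cball holomorphic_on_subset unfolding h_def by blast
  have h_nz: "h w \<noteq> 0" if "w \<in> ball z r" for w
    using nz that by (auto simp: h_def)
  have g_hol: "g holomorphic_on ball z r"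
    unfolding g_def using h_hol h_nz by (intro holomorphic_intros) auto
  have "(h has_field_derivative deriv h z) (at z)"
    using h_hol r(1) by (intro holomorphic_derivI[of _ "ball z r"]) auto
  then have "(g has_field_derivative inverse (h z)) (at z)"
    unfolding g_def using h_nz[of z] r(1)
    by (auto intro!: derivative_eq_intros simp: field_simps)
  then have "deriv g z \<noteq> 0"
    using h_nz[of z] r(1) by (auto dest!: DERIV_imp_deriv)
  then obtain e where e: "e > 0" "ball z e \<subseteq> ball z r" "inj_on g (ball z e)"
    using has_complex_derivative_locally_injective[OF g_hol, of z] r(1) by auto
  show thesis
  proof
    show "ball z e \<subseteq> S" using e(2) r(2) ball_subset_cball by blast
    show "g holomorphic_on ball z e" using g_hol e(2) holomorphic_on_subset by blast
    show "\<forall>w\<in>ball z e - {z}. f w = inverse (g w)"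
    proof
      fix w assume "w \<in> ball z e - {z}"
      then have "w \<in> cball z r - {z}" using e(2) ball_subset_cball[of z r] by blast
      then show "f w = inverse (g w)" using f_eq by (simp add: g_def h_def)
    qed
  qed (use e in \<open>auto simp: g_def\<close>)
qed

text \<open>The preimage of the disk is the image of the disk under \<open>w \<mapsto> h (1/w)\<close>, where \<open>h\<close> is the
  local inverse of \<open>1/f\<close>; described in this way it is visibly a domain.\<close>

lemma simple_pole_univalent_onto_disk:
  assumes "f holomorphic_on S - {z}" "open S" "z \<in> S" "is_pole f z" "zorder f z = -1" "r > 0"
  obtains c U where "open U" "connected U" "U \<subseteq> S - {z}" "inj_on f U" "f ` U = ball c r"
proof (rule simple_pole_reciprocal_locally_injective[OF assms(1-5)])
  fix g e assume e: "e > 0" "ball z e \<subseteq> S" and g_hol: "g holomorphic_on ball z e"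
    and g_inj: "inj_on g (ball z e)" and gz: "g z = 0"
    and f_eq: "\<forall>w\<in>ball z e - {z}. f w = inverse (g w)"
  obtain h where h_hol: "h holomorphic_on g ` ball z e"
    and hg: "\<And>w. w \<in> ball z e \<Longrightarrow> h (g w) = w"
    using holomorphic_has_inverse[OF g_hol open_ball g_inj] by metis
  have "open (g ` ball z e)"
    using open_mapping_thm3[OF g_hol open_ball g_inj] .
  moreover have "0 \<in> g ` ball z e"
    using gz e(1) by (metis centre_in_ball imageI)
  ultimately obtain d where d: "d > 0" "ball 0 d \<subseteq> g ` ball z e"
    by (meson openE)
  \<comment> \<open>Any disk outside the circle of radius \<open>1/d\<close> would do; this one touches it.\<close>
  define c :: complex where "c = of_real (1 / d + r)"
  have norm_c: "norm c = 1 / d + r"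
    using d(1) assms(6) unfolding c_def norm_of_real by simp
  have far: "1 / d < norm w" if "w \<in> ball c r" for w
    using that norm_triangle_ineq2[of c w] norm_c by (auto simp: dist_norm)
  have w_nz: "w \<noteq> 0" if "w \<in> ball c r" for w
    using far[OF that] d(1) by (auto simp: field_simps)
  have near: "inverse w \<in> g ` ball z e" if "w \<in> ball c r" for w
  proof -
    have "inverse (norm w) < inverse (1 / d)"
      using far[OF that] d(1) by (intro less_imp_inverse_less) auto
    then show ?thesis
      by (intro subsetD[OF d(2)]) (simp add: norm_inverse)
  qed
  define k where "k = (\<lambda>w. h (inverse w))"
  define U where "U = k ` ball c r"
  have k_dom: "k w \<in> ball z e - {z}" and fk: "f (k w) = w" if w: "w \<in> ball c r" for w
  proof -
    obtain v where v: "v \<in> ball z e" "g v = inverse w"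
      using near[OF w] by force
    have kv: "k w = v" using hg[OF v(1)] v(2) by (simp add: k_def)
    have "v \<noteq> z" using v(2) gz w_nz[OF w] by auto
    with v(1) kv show "k w \<in> ball z e - {z}" by simp
    then show "f (k w) = w" using f_eq kv v(2) by simp
  qed
  have k_inj: "inj_on k (ball c r)"
    by (rule inj_on_inverseI[of _ f]) (rule fk)
  have "inverse holomorphic_on ball c r"
    using w_nz by (intro holomorphic_intros) auto
  moreover have "inverse ` ball c r \<subseteq> g ` ball z e"
    using near by (rule image_subsetI)
  ultimately have k_hol: "k holomorphic_on ball c r"
    using holomorphic_on_compose_gen[OF _ h_hol, of inverse "ball c r"]
    by (simp add: k_def o_def)
  show thesis
  proof
    show "open U"
      unfolding U_def using open_mapping_thm3[OF k_hol open_ball k_inj] .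
    show "connected U"
      unfolding U_def
      by (intro connected_continuous_image holomorphic_on_imp_continuous_on k_hol) simp
    show "U \<subseteq> S - {z}" unfolding U_def using k_dom e(2) by blast
    show "inj_on f U" unfolding U_def using fk by (intro inj_on_inverseI[of _ k]) force
    show "f ` U = ball c r" unfolding U_def image_image using fk by simp
  qed
qed

lemma bloch_radius_le_landau_radius: "bloch_radius p f \<le> landau_radius p f"
proof -
  have "ball c r \<subseteq> finite_image p f" if "schlicht_disk p f c r" for c r
    using that unfolding schlicht_disk_def finite_image_def by (metis image_mono)
  moreover have "r > 0" if "schlicht_disk p f c r" for c r
    using that by (simp add: schlicht_disk_def)
  ultimately show ?thesis
    unfolding bloch_radius_def landau_radius_def by (intro Sup_subset_mono) blast
qed

lemma bloch_radius_class_A1: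
  assumes "0 < p" "p < 1" "f \<in> class_A1 p"
  shows "bloch_radius p f = \<infinity>"
proof -
  have f: "f holomorphic_on \<bbbD> - {of_real p}" "is_pole f (of_real p)" "zorder f (of_real p) = -1"
    using assms(3) by (auto simp: class_A1_def intro: analytic_imp_holomorphic)
  have "ennreal (of_nat n) \<le> bloch_radius p f" for n :: nat
  proof -
    have "\<exists>c. schlicht_disk p f c (real (Suc n))"
      by (rule simple_pole_univalent_onto_disk[OF f(1) _ _ f(2,3), of "real (Suc n)"])
        (use assms(1,2) in \<open>auto simp: schlicht_disk_def\<close>)
    then have "ennreal (real (Suc n)) \<le> bloch_radius p f"
      unfolding bloch_radius_def by (blast intro: Sup_upper)
    moreover have "ennreal (of_nat n) \<le> ennreal (real (Suc n))"
      by (intro ennreal_leI) simp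
    ultimately show ?thesis by (rule order_trans[rotated])
  qed
  then have "(SUP n. ennreal (of_nat n)) \<le> bloch_radius p f"
    by (intro SUP_least)
  then show ?thesis
    by (simp add: ennreal_of_nat_eq_real_of_nat[symmetric] ennreal_SUP_of_nat_eq_top top_unique)
qed

theorem theorem2p2:
  fixes p :: real
  assumes "0 < p" and "p < 1"
  shows "bloch_const p = \<infinity> \<and> landau_const p = \<infinity>"
proof -
  have "bloch_radius p f = top \<and> landau_radius p f = top" if "f \<in> class_A1 p" for f
    using bloch_radius_class_A1[OF assms that] bloch_radius_le_landau_radius[of p f]
    by (simp add: top_unique)
  then show ?thesis
    by (simp add: bloch_const_def landau_const_def)
qed

end
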